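(* Let $m,N\ge 1$ and let $(\alpha_0^{(1)},\ldots,\alpha_0^{(m)})\in\mathbb{Q}_p^m$ have a purely periodic multidimensional continued fraction of period $N$, $$(\alpha_0^{(1)},\ldots,\alpha_0^{(m)})=\left[\left(\overline{a_0^{(1)},\ldots,a_{N-1}^{(1)}}\right),\ldots,\left(\overline{a_0^{(m)},\ldots,a_{N-1}^{(m)}}\right)\right],$$ with characteristic polynomial $P(X)$. Then $\mu=\alpha_0^{(1)}\alpha_1^{(1)}\cdots\alpha_{N-1}^{(1)}$ is the root of $P(X)$ greatest in $p$-adic norm, i.e. $P(\mu)=0$ and $|\lambda|<|\mu|$ for every root $\lambda\neq\mu$ of $P(X)$ in an algebraic closure of $\mathbb{Q}_p$.
   Context: Let $p$ be an odd prime and $|\cdot|$ the $p$-adic norm on $\mathbb{Q}_p$, extended to an algebraic closure of $\mathbb{Q}_p$. Every $\alpha\in\mathbb{Q}_p$ can be written uniquely as $\alpha=\sum_{j=k}^{\infty}x_jp^j$ with $k\in\mathbb{Z}$ and $x_j\in\mathbb{Z}\cap(-\frac p2,\frac p2)$. The Browkin $s$-function is $s(\alpha)=\sum_{j=k}^{0}x_jp^j$ (the sum of the terms with $j\le 0$; it is $0$ if there are none). $p$-adic Jacobi--Perron algorithm of dimension $m$: on input $\bm{\alpha}_0=(\alpha_0^{(1)},\ldots,\alpha_0^{(m)})\in\mathbb{Q}_p^m$, for $n=0,1,2,\ldots$ put $a_n^{(i)}=s(\alpha_n^{(i)})$ for $i=1,\ldots,m$ (partial quotients). If $\alpha_n^{(m)}=a_n^{(m)}$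 the algorithm stops; otherwise set $\alpha_{n+1}^{(1)}=\dfrac{1}{\alpha_n^{(m)}-a_n^{(m)}}$ and $\alpha_{n+1}^{(i)}=\dfrac{\alpha_n^{(i-1)}-a_n^{(i-1)}}{\alpha_n^{(m)}-a_n^{(m)}}$ for $i=2,\ldots,m$, and continue. The $\alpha_n^{(i)}$ are the complete quotients; the sequences of partial quotients form the multidimensional continued fraction (MCF) of $\bm{\alpha}_0$. The MCF is purely periodic of period $N$ if the algorithm does not stop and $a_{k+N}^{(i)}=a_k^{(i)}$ for all $k\ge 0$ and $i=1,\ldots,m$. Its characteristic polynomial is the (monic) characteristic polynomial $P(X)$ of the $(m+1)\times(m+1)$ matrix $\mathcal{M}=\mathcal{A}_0\mathcal{A}_1\cdots\mathcal{A}_{N-1}$, where $$\mathcal{A}_n=\begin{pmatrix} a_n^{(1)}&1&0&\ldots&0\\ a_n^{(2)}&0&1&\ldots&0\\ \vdots&\vdots&\vdots&\vdots&\vdots\\ a_n^{(m)}&0&0&\ldots&1\\ 1&0&0&\ldots&0\end{pmatrix}.$$ *)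

theory Defs
  imports
    Complex_Main
    "HOL-Algebra.Algebraic_Closure_Type"
    "Jordan_Normal_Form.Char_Poly"
begin

section \<open>Absolute values and the field of p-adic numbers\<close>

locale nonarch_abs =
  fixes v :: "'a::field \<Rightarrow> real"
  assumes nonneg: "0 \<le> v x"
    and eq_0_iff: "v x = 0 \<longleftrightarrow> x = 0"
    and mult: "v (x * y) = v x * v y"
    and ultrametric: "v (x + y) \<le> max (v x) (v y)"

definition padic_abs_rat :: "nat \<Rightarrow> rat \<Rightarrow> real" where
  "padic_abs_rat p r =
     (if r = 0 then 0
      else (case quotient_of r of (a, b) \<Rightarrow>
        real p powi (int (multiplicity (int p) b) - int (multiplicity (int p) a))))"

text \<open>
  The field of p-adic numbers is the completion of the rationals with respect to the p-adic
  absolute value, which is unique up to a unique isometric isomorphism. A type cannot depend on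
  the number \<open>p\<close>, so the locale says that the field \<open>'a\<close> with the absolute value \<open>v\<close> is such a
  completion: \<open>v\<close> extends the p-adic absolute value, the rationals are dense, and every Cauchy
  sequence converges.
\<close>

locale padic_numbers = nonarch_abs v for v :: "'a::field_char_0 \<Rightarrow> real" +
  fixes p :: nat
  assumes prime_p: "prime p"
    and of_rat: "v (of_rat r) = padic_abs_rat p r"
    and dense: "0 < e \<Longrightarrow> \<exists>r. v (x - of_rat r) < e"
    and complete:
      "(\<And>e. 0 < e \<Longrightarrow> \<exists>K. \<forall>i\<ge>K. \<forall>j\<ge>K. v (f i - f j) < e)
       \<Longrightarrow> \<exists>l. (\<lambda>n::nat. v (f n - l)) \<longlonglongrightarrow> 0"

section \<open>The Browkin s-function\<close>

definition is_balanced_expansion ::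
    "('a::field_char_0 \<Rightarrow> real) \<Rightarrow> nat \<Rightarrow> 'a \<Rightarrow> (int \<Rightarrow> int) \<Rightarrow> bool" where
  "is_balanced_expansion v p \<alpha> x \<longleftrightarrow>
     (\<forall>j. - real p / 2 < real_of_int (x j) \<and> real_of_int (x j) < real p / 2) \<and>
     (\<exists>k. (\<forall>j<k. x j = 0) \<and>
          (\<lambda>n::nat. v (\<alpha> - (\<Sum>j\<in>{k..int n}. of_int (x j) * of_nat p powi j))) \<longlonglongrightarrow> 0)"

text \<open>For odd \<open>p\<close> every p-adic number has exactly one balanced expansion.\<close>

definition balanced_digits :: "('a::field_char_0 \<Rightarrow> real) \<Rightarrow> nat \<Rightarrow> 'a \<Rightarrow> int \<Rightarrow> int" where
  "balanced_digits v p \<alpha> = (THE x. is_balanced_expansion v p \<alpha> x)"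

definition browkin_s :: "('a::field_char_0 \<Rightarrow> real) \<Rightarrow> nat \<Rightarrow> 'a \<Rightarrow> 'a" where
  "browkin_s v p \<alpha> =
     (\<Sum>j | j \<le> 0 \<and> balanced_digits v p \<alpha> j \<noteq> 0.
        of_int (balanced_digits v p \<alpha> j) * of_nat p powi j)"

section \<open>The p-adic Jacobi--Perron algorithm\<close>

text \<open>
  A vector of dimension \<open>m\<close> is a function on \<open>nat\<close> of which only the values at \<open>1, \<dots>, m\<close> matter.
  The recursion is total: once some \<open>\<alpha>\<^sub>n\<^sup>(\<^sup>m\<^sup>) = a\<^sub>n\<^sup>(\<^sup>m\<^sup>)\<close>, the algorithm has stopped and the later
  terms are meaningless. Up to the first such \<open>n\<close> the terms are those of the algorithm, so it
  runs forever iff no such \<open>n\<close> exists.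
\<close>

primrec complete_quotient ::
    "('a::field_char_0 \<Rightarrow> real) \<Rightarrow> nat \<Rightarrow> nat \<Rightarrow> (nat \<Rightarrow> 'a) \<Rightarrow> nat \<Rightarrow> nat \<Rightarrow> 'a" where
  "complete_quotient v p m \<alpha>0 0 = \<alpha>0"
| "complete_quotient v p m \<alpha>0 (Suc n) =
     (let \<alpha> = complete_quotient v p m \<alpha>0 n;
          d = \<alpha> m - browkin_s v p (\<alpha> m)
      in (\<lambda>i. if i = 1 then 1 / d else (\<alpha> (i - 1) - browkin_s v p (\<alpha> (i - 1))) / d))"

definition partial_quotient ::
    "('a::field_char_0 \<Rightarrow> real) \<Rightarrow> nat \<Rightarrow> nat \<Rightarrow> (nat \<Rightarrow> 'a) \<Rightarrow> nat \<Rightarrow> nat \<Rightarrow> 'a" where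
  "partial_quotient v p m \<alpha>0 n i = browkin_s v p (complete_quotient v p m \<alpha>0 n i)"

definition mcf_infinite ::
    "('a::field_char_0 \<Rightarrow> real) \<Rightarrow> nat \<Rightarrow> nat \<Rightarrow> (nat \<Rightarrow> 'a) \<Rightarrow> bool" where
  "mcf_infinite v p m \<alpha>0 \<longleftrightarrow>
     (\<forall>n. complete_quotient v p m \<alpha>0 n m \<noteq> partial_quotient v p m \<alpha>0 n m)"

definition mcf_purely_periodic ::
    "('a::field_char_0 \<Rightarrow> real) \<Rightarrow> nat \<Rightarrow> nat \<Rightarrow> (nat \<Rightarrow> 'a) \<Rightarrow> nat \<Rightarrow> bool" where
  "mcf_purely_periodic v p m \<alpha>0 N \<longleftrightarrow>
     mcf_infinite v p m \<alpha>0 \<and>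
     (\<forall>k. \<forall>i\<in>{1..m}. partial_quotient v p m \<alpha>0 (k + N) i = partial_quotient v p m \<alpha>0 k i)"

text \<open>Matrix rows and columns are numbered from 0, so row \<open>i < m\<close> holds the index \<open>i + 1\<close>.\<close>

definition mcf_matrix ::
    "('a::field_char_0 \<Rightarrow> real) \<Rightarrow> nat \<Rightarrow> nat \<Rightarrow> (nat \<Rightarrow> 'a) \<Rightarrow> nat \<Rightarrow> 'a mat" where
  "mcf_matrix v p m \<alpha>0 n =
     mat (m + 1) (m + 1) (\<lambda>(i, j).
       if j = 0 then (if i < m then partial_quotient v p m \<alpha>0 n (i + 1) else 1)
       else if j = i + 1 then 1 else 0)"

primrec mcf_matrix_prod ::
    "('a::field_char_0 \<Rightarrow> real) \<Rightarrow> nat \<Rightarrow> nat \<Rightarrow> (nat \<Rightarrow> 'a) \<Rightarrow> nat \<Rightarrow> 'a mat" where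
  "mcf_matrix_prod v p m \<alpha>0 0 = 1\<^sub>m (m + 1)"
| "mcf_matrix_prod v p m \<alpha>0 (Suc n) = mcf_matrix_prod v p m \<alpha>0 n * mcf_matrix v p m \<alpha>0 n"

definition mcf_char_poly ::
    "('a::field_char_0 \<Rightarrow> real) \<Rightarrow> nat \<Rightarrow> nat \<Rightarrow> (nat \<Rightarrow> 'a) \<Rightarrow> nat \<Rightarrow> 'a poly" where
  "mcf_char_poly v p m \<alpha>0 N = char_poly (mcf_matrix_prod v p m \<alpha>0 N)"

end

theory Submission
  imports Defs
begin

text \<open>
  Write \<open>V\<^sub>n = (\<alpha>\<^sub>n\<^sup>(\<^sup>1\<^sup>), \<dots>, \<alpha>\<^sub>n\<^sup>(\<^sup>m\<^sup>), 1)\<close> for the complete quotients in homogeneous coordinates,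
  numbered from 0. The recursion of the algorithm says \<open>A\<^sub>n V\<^sub>n\<^sub>+\<^sub>1 = \<alpha>\<^sub>n\<^sub>+\<^sub>1\<^sup>(\<^sup>1\<^sup>) V\<^sub>n\<close>. If the complete
  quotients have period \<open>N\<close>, it follows that \<open>V\<^sub>0\<close> is an eigenvector of \<open>M = A\<^sub>0 \<cdots> A\<^sub>N\<^sub>-\<^sub>1\<close> with
  eigenvalue \<open>\<mu>\<close>. The whole argument rests on one analytic fact: \<open>\<alpha> - s(\<alpha>)\<close> has absolute value at
  most \<open>1/p\<close> (\<open>browkin_s_close\<close>). Hence, for \<open>n \<ge> 1\<close>, the first coordinate of \<open>V\<^sub>n\<close> has absolute
  value at least \<open>p\<close> and no other coordinate is larger; this is the locale \<open>jp_orbit\<close>.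

  Only the partial quotients are known to be periodic. But the complete quotients are determined by
  the partial ones: the distance between two orbits with the same partial quotients is at most 1
  and is divided by \<open>p\<close> with each step backwards, so it vanishes (\<open>jp_orbit_unique\<close>). Comparing an
  orbit with its shift by \<open>N\<close> gives the period of the complete quotients.

  For the other roots, let \<open>A\<^sub>n\<close> act from the quotient of the space by the line through \<open>V\<^sub>n\<^sub>+\<^sub>1\<close> to
  the quotient by the line through \<open>V\<^sub>n\<close>. In the bases given by the unit vectors other than the
  first, this map shifts the basis, and it sends one basis vector to the one with coordinates
  \<open>- V\<^sub>n(i) / V\<^sub>n(0)\<close>. All entries have absolute value at most 1, so the map does not increase the
  maximum norm (\<open>quotient_norm_jp_matrix_le\<close>). Going once around the period, \<open>M\<close> does not increase
  the norm on the quotient by its eigenline, and each eigenvalue other than \<open>\<mu>\<close> has absolute value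
  at most 1, whereas \<open>\<mu>\<close> is a product of factors of absolute value at least \<open>p\<close>. This argument takes
  place over any field with an extension of the absolute value, in particular over the algebraic
  closure. There the inequality is even \<open>\<bar>\<lambda>\<bar> \<le> 1 < \<bar>\<mu>\<bar>\<close>.
\<close>

section \<open>Non-archimedean absolute values\<close>

context nonarch_abs
begin

lemma v_one: "v 1 = 1"
proof -
  have "v 1 * v 1 = v 1" using mult[of 1 1] by simp
  then show ?thesis using eq_0_iff[of 1] by simp
qed

lemma v_minus: "v (- x) = v x"
proof -
  have "v (-1) * v (-1) = 1" using mult[of "-1" "-1"] v_one by simp
  then have "v (-1) = 1"
    using nonneg[of "-1"] by (metis abs_of_nonneg power2_eq_square real_sqrt_abs real_sqrt_one)
  then show ?thesis using mult[of "-1" x] by simp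
qed

lemma v_diff_le: "v (x - y) \<le> max (v x) (v y)"
  using ultrametric[of x "- y"] v_minus by simp

lemma v_inverse: "v (inverse x) = inverse (v x)"
proof (cases "x = 0")
  case True
  then show ?thesis using eq_0_iff[of 0] by simp
next
  case False
  then have "v x * v (inverse x) = 1" using mult[of x "inverse x"] v_one by simp
  then show ?thesis by (metis inverse_unique)
qed

lemma v_divide: "v (x / y) = v x / v y"
  by (simp add: divide_inverse mult v_inverse)

lemma v_power: "v (x ^ n) = v x ^ n"
  by (induction n) (simp_all add: v_one mult)

lemma v_powi: "v (x powi k) = v x powi k"
  by (simp add: power_int_def v_power v_inverse)

lemma v_prod: "v (\<Prod>i\<in>A. f i) = (\<Prod>i\<in>A. v (f i))"
  by (induction A rule: infinite_finite_induct) (simp_all add: v_one mult)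

lemma v_sum_le:
  assumes "\<And>i. i \<in> A \<Longrightarrow> v (f i) \<le> c" "0 \<le> c"
  shows "v (\<Sum>i\<in>A. f i) \<le> c"
  using assms
proof (induction A rule: infinite_finite_induct)
  case (insert a A)
  have "v (f a + sum f A) \<le> max (v (f a)) (v (sum f A))" by (rule ultrametric)
  also have "\<dots> \<le> c" using insert by simp
  finally show ?case using insert by simp
qed (simp_all add: eq_0_iff[THEN iffD2])

lemma v_eq_if_diff_less:
  assumes "v (x - y) < v x"
  shows "v y = v x"
proof -
  have "v y \<le> max (v x) (v (x - y))" using v_diff_le[of x "x - y"] by simp
  moreover have "v x \<le> max (v (x - y)) (v y)" using ultrametric[of "x - y" y] by simp
  ultimately show ?thesis using assms by simp
qed

end

section \<open>Balanced expansions of p-adic numbers\<close>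

context padic_numbers
begin

lemma p_gt_1: "1 < real p"
  using prime_p prime_gt_1_nat by auto

lemma v_of_int: "d \<noteq> 0 \<Longrightarrow> v (of_int d) = real p powi (- int (multiplicity (int p) d))"
  using of_rat[of "rat_of_int d"] by (simp add: padic_abs_rat_def)

lemma v_of_nat_p: "v (of_nat p) = 1 / real p"
proof -
  have "v (of_int (int p)) = real p powi (- int (multiplicity (int p) (int p)))"
    by (rule v_of_int) (use p_gt_1 in simp)
  moreover have "multiplicity (int p) (int p) = 1"
    by (rule multiplicity_self) (use p_gt_1 in auto)
  ultimately show ?thesis by (simp add: power_int_minus divide_inverse)
qed

lemma v_of_int_le_1: "v (of_int d) \<le> 1"
proof (cases "d = 0")
  case True
  then show ?thesis using eq_0_iff[of 0] by simp
next
  case False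
  have "real p powi (- int k) \<le> 1" for k
    using p_gt_1 by (simp add: power_int_minus inverse_le_1_iff)
  then show ?thesis using v_of_int[OF False] by simp
qed

lemma v_of_int_unit: "\<not> int p dvd d \<Longrightarrow> v (of_int d) = 1"
  by (subst v_of_int) (auto simp: not_dvd_imp_multiplicity_0)

lemma v_of_int_dvd:
  assumes "int p dvd d"
  shows "v (of_int d) \<le> 1 / real p"
proof -
  obtain e where "d = int p * e" using assms by blast
  then have "v (of_int d) = 1 / real p * v (of_int e)" by (simp add: mult v_of_nat_p)
  also have "\<dots> \<le> 1 / real p * 1"
    by (rule mult_left_mono) (use v_of_int_le_1 p_gt_1 in auto)
  finally show ?thesis by simp
qed

lemma v_p_powi: "v (of_nat p powi k) = real p powi (- k)"
  by (simp add: v_powi v_of_nat_p power_int_minus power_int_divide_distrib divide_inverse power_int_inverse)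

lemma p_powi_mono: "i \<le> j \<Longrightarrow> real p powi i \<le> real p powi j"
  using p_gt_1 by (simp add: power_int_increasing)

lemma p_powi_strict_mono: "i < j \<Longrightarrow> real p powi i < real p powi j"
  using p_gt_1 by (simp add: power_int_strict_increasing)

lemma p_powi_pos: "0 < real p powi k"
  using p_gt_1 by simp

text \<open>
  By density \<open>x\<close> may be replaced by a rational \<open>a / b\<close>; its denominator is prime to \<open>p\<close>, so \<open>b\<close> can be
  inverted modulo \<open>p\<close>, and for odd \<open>p\<close> each residue class has a representative in
  \<open>(- p / 2, p / 2)\<close>.
\<close>

lemma balanced_digit_exists:
  assumes "odd p" "v x \<le> 1"
  shows "\<exists>d::int. - real p / 2 < real_of_int d \<and> real_of_int d < real p / 2 \<and>
                  v (x - of_int d) \<le> 1 / real p"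
proof -
  obtain r where r: "v (x - of_rat r) < 1 / real p"
    using dense[of "1 / real p" x] p_gt_1 by auto
  have "v (of_rat r) \<le> max (v x) (v (x - of_rat r))"
    using v_diff_le[of x "x - of_rat r"] by simp
  then have vr: "v (of_rat r) \<le> 1" using assms(2) r p_gt_1 by (smt (verit) divide_le_eq_1)
  obtain a b where ab: "quotient_of r = (a, b)" by (cases "quotient_of r")
  have b: "b > 0" "coprime a b" "r = of_int a / of_int b"
    using quotient_of_denom_pos quotient_of_coprime quotient_of_div ab by auto
  have rab: "of_rat r = of_int a / (of_int b :: 'a)"
    using b by (simp add: of_rat_divide)
  have nb: "\<not> int p dvd b"
  proof
    assume pb: "int p dvd b"
    then have "\<not> int p dvd a"
      using b(2) prime_p by (metis coprime_common_divisor not_prime_unit prime_nat_int_transfer)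
    then have "v (of_rat r) = 1 / v (of_int b)" using rab v_of_int_unit by (simp add: v_divide)
    then have "1 / v (of_int b) \<le> 1" using vr by linarith
    moreover have "v (of_int b) \<le> 1 / real p" using v_of_int_dvd pb by blast
    moreover have "0 < v (of_int b)" using nonneg eq_0_iff b(1)
      by (metis less_eq_real_def of_int_eq_0_iff less_irrefl)
    ultimately have "real p * v (of_int b) \<le> 1" "1 \<le> v (of_int b)"
      using p_gt_1 by (simp_all add: field_simps)
    moreover have "real p * 1 \<le> real p * v (of_int b)" using calculation(2) by (rule mult_left_mono) simp
    ultimately show False using p_gt_1 by simp
  qed
  then have "coprime b (int p)"
    using prime_p by (metis coprime_commute prime_imp_coprime prime_nat_int_transfer)
  then obtain u t where ut: "u * b + t * int p = 1"
    using bezout_int[of b "int p"] by auto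
  \<comment> \<open>\<open>c\<close> is \<open>a / b\<close> modulo \<open>p\<close>, and \<open>d\<close> is its representative closest to 0.\<close>
  define c where "c = a * u"
  define h where "h = int p div 2"
  define e where "e = (c + h) mod int p"
  define d where "d = e - h"
  have "int p dvd (c + h) - e" unfolding e_def by simp
  then have cd: "int p dvd c - d" unfolding d_def by (simp add: algebra_simps)
  have "a - d * b = a * (u * b + t * int p) - d * b" using ut by simp
  also have "\<dots> = (c - d) * b + a * t * int p" unfolding c_def by (simp add: algebra_simps)
  finally have "int p dvd a - d * b" using cd by simp
  then have "v (of_int (a - d * b)) \<le> 1 / real p" by (rule v_of_int_dvd)
  moreover have "of_rat r - of_int d = of_int (a - d * b) / (of_int b :: 'a)"
    using rab b(1) by (simp add: field_simps)
  ultimately have "v (of_rat r - of_int d) \<le> 1 / real p"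
    using v_of_int_unit[OF nb] by (simp add: v_divide)
  moreover have "v (x - of_int d) \<le> max (v (x - of_rat r)) (v (of_rat r - of_int d))"
    using ultrametric[of "x - of_rat r" "of_rat r - of_int d"] by simp
  ultimately have v: "v (x - of_int d) \<le> 1 / real p" using r by simp
  have "0 \<le> e" "e < int p" unfolding e_def using p_gt_1 by auto
  moreover have "int p = 2 * h + 1" unfolding h_def using \<open>odd p\<close> by simp
  ultimately have "- int p < 2 * d \<and> 2 * d < int p" unfolding d_def by auto
  then have "- real p < 2 * real_of_int d \<and> 2 * real_of_int d < real p" by linarith
  then show ?thesis using v by (intro exI[of _ d]) simp
qed

lemma balanced_digit_exists_scaled:
  assumes "odd p" "v x \<le> real p powi (- j)"
  shows "\<exists>d::int. - real p / 2 < real_of_int d \<and> real_of_int d < real p / 2 \<and>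
                  v (x - of_int d * of_nat p powi j) \<le> real p powi (- (j + 1))"
proof -
  define q where "q = (of_nat p :: 'a) powi j"
  have p0: "(of_nat p :: 'a) \<noteq> 0" using p_gt_1 by auto
  have q0: "q \<noteq> 0" using p0 by (simp add: q_def)
  have vq: "v q = real p powi (- j)" by (simp add: q_def v_p_powi)
  have "v (x / q) \<le> 1" using assms(2) vq p_powi_pos[of "-j"] by (simp add: v_divide)
  from balanced_digit_exists[OF assms(1) this] obtain d :: int
    where d: "- real p / 2 < real_of_int d" "real_of_int d < real p / 2"
      and vd: "v (x / q - of_int d) \<le> 1 / real p" by blast
  have "x - of_int d * q = q * (x / q - of_int d)" using q0 by (simp add: field_simps)
  then have "v (x - of_int d * q) = v q * v (x / q - of_int d)" by (simp add: mult)
  also have "\<dots> \<le> v q * (1 / real p)" by (rule mult_left_mono[OF vd nonneg])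
  also have "\<dots> = real p powi (- j) / real p" using vq by simp
  also have "\<dots> = real p powi (- j - 1)" using p_gt_1 by (subst power_int_diff) auto
  finally show ?thesis using d unfolding q_def by (intro exI[of _ d]) simp
qed

lemma p_powi_minus_tendsto_0: "(\<lambda>n::nat. real p powi (- int n)) \<longlonglongrightarrow> 0"
proof -
  have "(\<lambda>n. (1 / real p) ^ n) \<longlonglongrightarrow> 0"
    by (rule LIMSEQ_realpow_zero) (use p_gt_1 in auto)
  moreover have "(1 / real p) ^ n = real p powi (- int n)" for n
    by (simp add: power_int_minus divide_inverse power_inverse)
  ultimately show ?thesis by simp
qed

text \<open>
  The partial sums of an expansion end at indices \<open>n \<ge> 0\<close>. With a start \<open>k \<le> 0\<close> none of them ends
  before it begins, so each is \<open>\<alpha>\<close> minus a remainder of the digit algorithm.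
\<close>

lemma v_le_p_powi: "\<exists>k\<le>0. v x \<le> real p powi (- k)"
proof -
  obtain n where "v x < real p ^ n" using real_arch_pow p_gt_1 by blast
  then show ?thesis by (intro exI[of _ "- int n"]) simp
qed

text \<open>
  Digits are chosen greedily: after the digits \<open>k, \<dots>, k + n - 1\<close> have been subtracted, the
  remainder \<open>R n\<close> is at most \<open>p\<^sup>-\<^sup>(\<^sup>k\<^sup>+\<^sup>n\<^sup>)\<close> in absolute value, which leaves room for one more digit.
\<close>

lemma balanced_expansion_exists:
  assumes "odd p"
  shows "\<exists>x. is_balanced_expansion v p \<alpha> x"
proof -
  obtain k where k: "k \<le> 0" "v \<alpha> \<le> real p powi (- k)" using v_le_p_powi by blast
  define dig where "dig = (\<lambda>y j. SOME d::int. - real p / 2 < real_of_int d \<and>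
    real_of_int d < real p / 2 \<and> v (y - of_int d * of_nat p powi j) \<le> real p powi (- (j + 1)))"
  have dig: "- real p / 2 < real_of_int (dig y j) \<and> real_of_int (dig y j) < real p / 2 \<and>
      v (y - of_int (dig y j) * of_nat p powi j) \<le> real p powi (- (j + 1))"
    if "v y \<le> real p powi (- j)" for y j
    unfolding dig_def by (rule someI_ex) (rule balanced_digit_exists_scaled[OF assms that])
  define R where "R = rec_nat \<alpha> (\<lambda>n y. y - of_int (dig y (k + int n)) * of_nat p powi (k + int n))"
  have R0: "R 0 = \<alpha>"
    and RSuc: "R (Suc n) = R n - of_int (dig (R n) (k + int n)) * of_nat p powi (k + int n)" for n
    by (simp_all add: R_def)
  have vR: "v (R n) \<le> real p powi (- (k + int n))" for n
  proof (induction n)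
    case 0
    then show ?case using k R0 by simp
  next
    case (Suc n)
    then show ?case using dig[OF Suc] by (simp add: RSuc add.commute add.left_commute)
  qed
  define x where "x j = (if j < k then 0 else dig (R (nat (j - k))) j)" for j
  have bal: "- real p / 2 < real_of_int (x j) \<and> real_of_int (x j) < real p / 2" for j
  proof (cases "j < k")
    case False
    then show ?thesis using dig[of "R (nat (j - k))" j] vR[of "nat (j - k)"] by (simp add: x_def)
  qed (use p_gt_1 in \<open>simp add: x_def\<close>)
  have part: "\<alpha> - (\<Sum>j\<in>{k..<k + int n}. of_int (x j) * of_nat p powi j) = R n" for n
  proof (induction n)
    case 0
    then show ?case by (simp add: R0)
  next
    case (Suc n)
    have "{k..<k + int (Suc n)} = insert (k + int n) {k..<k + int n}" by auto
    then show ?case using Suc by (simp add: RSuc x_def algebra_simps)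
  qed
  have "v (\<alpha> - (\<Sum>j\<in>{k..int n}. of_int (x j) * of_nat p powi j)) \<le> real p powi (- int n)" for n
  proof -
    have "{k..int n} = {k..<k + int (nat (int n + 1 - k))}" using k by auto
    then have "v (\<alpha> - (\<Sum>j\<in>{k..int n}. of_int (x j) * of_nat p powi j)) = v (R (nat (int n + 1 - k)))"
      using part[of "nat (int n + 1 - k)"] by simp
    also have "\<dots> \<le> real p powi (- (k + int (nat (int n + 1 - k))))" by (rule vR)
    also have "\<dots> \<le> real p powi (- int n)" by (rule p_powi_mono) (use k in auto)
    finally show ?thesis .
  qed
  then have "(\<lambda>n. v (\<alpha> - (\<Sum>j\<in>{k..int n}. of_int (x j) * of_nat p powi j))) \<longlonglongrightarrow> 0"
    by (intro tendsto_sandwich[OF _ _ tendsto_const p_powi_minus_tendsto_0]) (auto simp: nonneg)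
  then have "is_balanced_expansion v p \<alpha> x"
    unfolding is_balanced_expansion_def using bal by (auto intro!: exI[of _ k] simp: x_def)
  then show ?thesis by blast
qed

lemma v_tail_le:
  assumes "0 \<le> c" "\<And>j. j \<in> A \<Longrightarrow> real p powi (- j) \<le> c"
  shows "v (\<Sum>j\<in>A. of_int (x j) * of_nat p powi j) \<le> c"
proof (rule v_sum_le)
  fix j assume j: "j \<in> A"
  have "v (of_int (x j) * of_nat p powi j) = v (of_int (x j)) * real p powi (- j)"
    by (simp add: mult v_p_powi)
  also have "\<dots> \<le> 1 * real p powi (- j)"
    by (rule mult_right_mono) (use v_of_int_le_1 p_powi_pos[of "-j"] in auto)
  also have "\<dots> \<le> c" using assms(2)[OF j] by simp
  finally show "v (of_int (x j) * of_nat p powi j) \<le> c" .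
qed fact

text \<open>
  The start \<open>k\<close> of an expansion can be moved down at will, because only zero digits are added. Two
  expansions can thus be given a common start, and a start at most 0 exists.
\<close>

lemma balanced_expansion_lower_start:
  assumes "is_balanced_expansion v p \<alpha> x"
  shows "\<exists>k0. \<forall>k\<le>k0. (\<forall>j<k. x j = 0) \<and>
    (\<lambda>n::nat. v (\<alpha> - (\<Sum>j\<in>{k..int n}. of_int (x j) * of_nat p powi j))) \<longlonglongrightarrow> 0"
proof -
  obtain k0 where k0: "\<forall>j<k0. x j = 0"
    "(\<lambda>n::nat. v (\<alpha> - (\<Sum>j\<in>{k0..int n}. of_int (x j) * of_nat p powi j))) \<longlonglongrightarrow> 0"
    using assms unfolding is_balanced_expansion_def by blast
  show ?thesis
  proof (intro exI[of _ k0] allI impI conjI)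
    fix k assume k: "k \<le> k0"
    show "x j = 0" if "j < k" for j using that k k0(1) by simp
    have "(\<Sum>j\<in>{k..int n}. of_int (x j) * of_nat p powi j) =
          (\<Sum>j\<in>{k0..int n}. of_int (x j) * (of_nat p :: 'a) powi j)" for n
      by (rule sum.mono_neutral_right) (use k k0(1) in auto)
    then show "(\<lambda>n::nat. v (\<alpha> - (\<Sum>j\<in>{k..int n}. of_int (x j) * of_nat p powi j))) \<longlonglongrightarrow> 0"
      using k0(2) by simp
  qed
qed

text \<open>
  If two expansions differ, let \<open>l\<close> be the first index where they do. Their digits there differ by
  less than \<open>p\<close>, hence by a unit, so from then on the partial sums stay at distance exactly
  \<open>p\<^sup>-\<^sup>l\<close> and cannot have the same limit.
\<close>

lemma balanced_expansion_unique:
  assumes "is_balanced_expansion v p \<alpha> x" "is_balanced_expansion v p \<alpha> y"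
  shows "x = y"
proof (rule ccontr)
  assume "x \<noteq> y"
  then obtain i where i: "x i \<noteq> y i" by auto
  obtain kx where kx: "\<forall>k\<le>kx. (\<forall>j<k. x j = 0) \<and>
    (\<lambda>n::nat. v (\<alpha> - (\<Sum>j\<in>{k..int n}. of_int (x j) * of_nat p powi j))) \<longlonglongrightarrow> 0"
    using balanced_expansion_lower_start[OF assms(1)] by (rule exE)
  obtain ky where ky: "\<forall>k\<le>ky. (\<forall>j<k. y j = 0) \<and>
    (\<lambda>n::nat. v (\<alpha> - (\<Sum>j\<in>{k..int n}. of_int (y j) * of_nat p powi j))) \<longlonglongrightarrow> 0"
    using balanced_expansion_lower_start[OF assms(2)] by (rule exE)
  define k where "k = min kx ky"
  define z where "z j = x j - y j" for j
  have zk: "z j = 0" if "j < k" for j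
    using that kx[THEN spec, of k] ky[THEN spec, of k] by (simp add: z_def k_def)
  define S where "S n = (\<Sum>j\<in>{k..int n}. of_int (z j) * (of_nat p :: 'a) powi j)" for n :: nat
  define Dx where "Dx n = \<alpha> - (\<Sum>j\<in>{k..int n}. of_int (x j) * (of_nat p :: 'a) powi j)" for n :: nat
  define Dy where "Dy n = \<alpha> - (\<Sum>j\<in>{k..int n}. of_int (y j) * (of_nat p :: 'a) powi j)" for n :: nat
  have XY: "(\<lambda>n. v (Dx n)) \<longlonglongrightarrow> 0" "(\<lambda>n. v (Dy n)) \<longlonglongrightarrow> 0"
    using kx[THEN spec, of k] ky[THEN spec, of k] by (simp_all add: Dx_def Dy_def k_def)
  have "S n = Dy n - Dx n" for n
    by (simp add: S_def Dx_def Dy_def z_def left_diff_distrib sum_subtractf)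
  then have le: "v (S n) \<le> max (v (Dy n)) (v (Dx n))" for n
    using v_diff_le[of "Dy n" "Dx n"] by simp
  have max_tendsto_0: "(\<lambda>n. max (v (Dy n)) (v (Dx n))) \<longlonglongrightarrow> 0"
    using tendsto_max[OF XY(2,1)] by simp
  have S_tendsto_0: "(\<lambda>n. v (S n)) \<longlonglongrightarrow> 0"
    by (rule tendsto_sandwich[OF always_eventually always_eventually tendsto_const max_tendsto_0])
       (intro allI nonneg le)+
  define l where "l = k + int (LEAST n. z (k + int n) \<noteq> 0)"
  have ik: "k \<le> i" using zk[of i] i by (force simp: z_def)
  have ex: "z (k + int (nat (i - k))) \<noteq> 0" using i ik by (simp add: z_def)
  have zl: "z l \<noteq> 0" unfolding l_def by (rule LeastI[of "\<lambda>n. z (k + int n) \<noteq> 0", OF ex])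
  have lk: "k \<le> l" by (simp add: l_def)
  have zless: "z j = 0" if "j < l" for j
  proof (cases "j < k")
    case False
    then have "nat (j - k) < (LEAST n. z (k + int n) \<noteq> 0)" using that by (simp add: l_def)
    from not_less_Least[OF this] False show ?thesis by simp
  qed (rule zk)
  have zabs: "\<bar>z l\<bar> < int p"
  proof -
    have "- real p / 2 < real_of_int (x l)" "real_of_int (x l) < real p / 2"
         "- real p / 2 < real_of_int (y l)" "real_of_int (y l) < real p / 2"
      using assms unfolding is_balanced_expansion_def by blast+
    then have "\<bar>real_of_int (z l)\<bar> < real p" unfolding z_def by (simp add: abs_if)
    then show ?thesis by linarith
  qed
  have vz: "v (of_int (z l)) = 1"
    by (rule v_of_int_unit) (use zabs zl dvd_imp_le_int[of "z l" "int p"] in auto)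
  have "real p powi (- l) \<le> v (S n)" if n: "int n \<ge> l" for n
  proof -
    have "S n = (\<Sum>j\<in>{l..int n}. of_int (z j) * (of_nat p :: 'a) powi j)"
      unfolding S_def by (rule sum.mono_neutral_right) (use lk in \<open>auto intro!: zless\<close>)
    also have "{l..int n} = insert l {l+1..int n}" using n by auto
    finally have S: "S n = of_int (z l) * of_nat p powi l +
      (\<Sum>j\<in>{l+1..int n}. of_int (z j) * (of_nat p :: 'a) powi j)" (is "_ = ?a + ?b") by simp
    have a: "v ?a = real p powi (- l)" by (simp add: mult vz v_p_powi)
    have b: "v ?b \<le> real p powi (- l - 1)"
      by (rule v_tail_le) (use p_powi_pos[of "- l - 1"] in \<open>auto intro!: p_powi_mono\<close>)
    have "v (?a - S n) < v ?a"
      using a b p_powi_strict_mono[of "- l - 1" "- l"] S v_minus[of ?b] by simp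
    then have "v (S n) = v ?a" by (rule v_eq_if_diff_less)
    then show ?thesis using a by simp
  qed
  then have "eventually (\<lambda>n. real p powi (- l) \<le> v (S n)) sequentially"
    by (intro eventually_sequentiallyI[of "nat l"]) auto
  then have "real p powi (- l) \<le> 0"
    using S_tendsto_0 by (rule tendsto_lowerbound[OF _ _ sequentially_bot, rotated])
  then show False using p_powi_pos[of "- l"] by simp
qed

text \<open>
  What \<open>s\<close> omits is a limit of sums of terms with \<open>j \<ge> 1\<close>, each at most \<open>1/p\<close> in absolute value.
\<close>

lemma browkin_s_close:
  assumes "odd p"
  shows "v (\<alpha> - browkin_s v p \<alpha>) \<le> 1 / real p"
proof -
  define x where "x = balanced_digits v p \<alpha>"
  have "\<exists>!x. is_balanced_expansion v p \<alpha> x"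
    using balanced_expansion_exists[OF assms] balanced_expansion_unique by blast
  then have "is_balanced_expansion v p \<alpha> x"
    unfolding x_def balanced_digits_def by (rule theI')
  from balanced_expansion_lower_start[OF this] obtain k0 where
    "\<forall>k\<le>k0. (\<forall>j<k. x j = 0) \<and>
      (\<lambda>n::nat. v (\<alpha> - (\<Sum>j\<in>{k..int n}. of_int (x j) * of_nat p powi j))) \<longlonglongrightarrow> 0" by blast
  then obtain k where k: "k \<le> 0" "\<forall>j<k. x j = 0"
      "(\<lambda>n::nat. v (\<alpha> - (\<Sum>j\<in>{k..int n}. of_int (x j) * of_nat p powi j))) \<longlonglongrightarrow> 0"
    by (metis min.cobounded1 min.cobounded2)
  have s: "browkin_s v p \<alpha> = (\<Sum>j\<in>{k..0}. of_int (x j) * of_nat p powi j)"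
    unfolding browkin_s_def x_def[symmetric]
    by (rule sum.mono_neutral_left) (use k(2) in \<open>auto simp: not_less[symmetric]\<close>)
  have "eventually (\<lambda>n::nat. v (\<alpha> - (\<Sum>j\<in>{k..int n}. of_int (x j) * of_nat p powi j)) < 1 / real p)
      sequentially"
    by (rule order_tendstoD(2)[OF k(3)]) (use p_gt_1 in simp)
  then obtain n :: nat where
    n: "v (\<alpha> - (\<Sum>j\<in>{k..int n}. of_int (x j) * of_nat p powi j)) < 1 / real p" (is "v (\<alpha> - ?S) < _")
    by (auto simp: eventually_sequentially)
  have "{k..int n} = {k..0} \<union> {1..int n}" using k(1) by auto
  then have S: "?S = browkin_s v p \<alpha> + (\<Sum>j\<in>{1..int n}. of_int (x j) * of_nat p powi j)"
    (is "_ = _ + ?T") unfolding s by (simp only:) (rule sum.union_disjoint; auto)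
  have "v ?T \<le> real p powi (- 1)"
    by (rule v_tail_le) (simp_all add: p_powi_mono del: power_int_minus1_right)
  then have T: "v ?T \<le> 1 / real p" by (simp add: power_int_minus divide_inverse)
  have "\<alpha> - browkin_s v p \<alpha> = (\<alpha> - ?S) + ?T" using S by simp
  then have "v (\<alpha> - browkin_s v p \<alpha>) \<le> max (v (\<alpha> - ?S)) (v ?T)" using ultrametric by metis
  then show ?thesis using n T by simp
qed

end

section \<open>Matrix products of Jacobi--Perron type\<close>

text \<open>
  Separating the shape of the matrices from the origin of their entries makes it possible to
  transport them to the algebraic closure.
\<close>

definition jp_matrix :: "nat \<Rightarrow> (nat \<Rightarrow> 'a::field) \<Rightarrow> 'a mat" where
  "jp_matrix m a = mat (m + 1) (m + 1) (\<lambda>(i, j).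
     if j = 0 then (if i < m then a i else 1) else if j = i + 1 then 1 else 0)"

primrec jp_prod :: "nat \<Rightarrow> (nat \<Rightarrow> nat \<Rightarrow> 'a::field) \<Rightarrow> nat \<Rightarrow> 'a mat" where
  "jp_prod m a 0 = 1\<^sub>m (m + 1)"
| "jp_prod m a (Suc n) = jp_prod m a n * jp_matrix m (a n)"

lemma jp_matrix_carrier [simp]: "jp_matrix m a \<in> carrier_mat (m + 1) (m + 1)"
  by (simp add: jp_matrix_def)

lemma jp_prod_carrier [simp]: "jp_prod m a n \<in> carrier_mat (m + 1) (m + 1)"
proof (induction n)
  case (Suc n)
  then show ?case using mult_carrier_mat[OF Suc jp_matrix_carrier] by simp
qed simp

lemma jp_matrix_mult_vec:
  assumes x: "x \<in> carrier_vec (m + 1)" and i: "i \<le> m"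
  shows "(jp_matrix m a *\<^sub>v x) $ i = (if i < m then a i * x $ 0 + x $ Suc i else x $ 0)"
proof -
  have "(jp_matrix m a *\<^sub>v x) $ i = (\<Sum>j\<in>{0..<Suc m}. jp_matrix m a $$ (i, j) * x $ j)"
    using x i by (simp add: jp_matrix_def scalar_prod_def)
  also have "\<dots> = (\<Sum>j\<in>{0..<Suc m}.
      (if j = 0 then (if i < m then a i else 1) else if j = i + 1 then 1 else 0) * x $ j)"
    by (rule sum.cong) (use i in \<open>auto simp: jp_matrix_def\<close>)
  also have "\<dots> = (if i < m then a i else 1) * x $ 0 +
      (\<Sum>j\<in>{0..<m}. (if j = i then 1 else 0) * x $ Suc j)"
    by (subst sum.atLeast0_lessThan_Suc_shift) (simp add: o_def)
  also have "\<dots> = (if i < m then a i * x $ 0 + x $ Suc i else x $ 0)"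
    using i by (simp add: if_distrib[of "\<lambda>y. y * _"] sum.delta' cong: if_cong)
  finally show ?thesis .
qed

lemma jp_prod_Suc_mult_vec:
  assumes "x \<in> carrier_vec (m + 1)"
  shows "jp_prod m a (Suc n) *\<^sub>v x = jp_prod m a n *\<^sub>v (jp_matrix m (a n) *\<^sub>v x)"
  using assoc_mult_mat_vec[OF jp_prod_carrier jp_matrix_carrier assms] by simp

lemma map_mat_jp_prod:
  assumes "comm_ring_hom h"
  shows "map_mat h (jp_prod m a n) = jp_prod m (\<lambda>n i. h (a n i)) n"
proof -
  interpret comm_ring_hom h by fact
  have "map_mat h (jp_matrix m b) = jp_matrix m (\<lambda>i. h (b i))" for b
    by (rule eq_matI) (auto simp: jp_matrix_def)
  then show ?thesis
    by (induction n) (auto simp: mat_hom_mult[OF jp_prod_carrier jp_matrix_carrier] mat_hom_one)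
qed

section \<open>Dominated Jacobi--Perron orbits\<close>

text \<open>
  The coordinates of \<open>V n\<close> are the complete quotients at time \<open>n\<close>, numbered from 0 and followed by a
  last coordinate 1. The convention turns the two cases of the algorithm's recursion into the single
  equation \<open>step\<close>. The bounds start at time 1 because nothing is known about the input of the
  algorithm. Partial quotients are arbitrary here, so the notion passes to extension fields.
\<close>

locale jp_orbit = nonarch_abs v for v :: "'a::field \<Rightarrow> real" +
  fixes m :: nat and c :: real and a V :: "nat \<Rightarrow> nat \<Rightarrow> 'a"
  assumes m_pos: "0 < m"
    and c_gt_1: "1 < c"
    and last: "V n m = 1"
    and step: "i < m \<Longrightarrow> V n i = a n i + V (Suc n) (Suc i) / V (Suc n) 0"
    and large: "c \<le> v (V (Suc n) 0)"
    and dominated: "i \<le> m \<Longrightarrow> v (V (Suc n) i) \<le> v (V (Suc n) 0)"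

text \<open>
  The coordinate \<open>V n i\<close> is, up to a common summand, a ratio \<open>A' / A\<close> at time \<open>n + 1\<close>. Since
  \<open>A' / A - B' / B = (A' - B') / A - (B' / B) (A - B) / A\<close>, and \<open>B' / B\<close> is at most 1, the
  difference at time \<open>n + 1\<close> is divided by at least \<open>\<bar>A\<bar> \<ge> c\<close>.
\<close>

lemma jp_orbit_contraction:
  assumes "jp_orbit v m c a V" "jp_orbit v m c a W" "i < m" "0 \<le> e"
    and e: "\<And>j. j \<le> m \<Longrightarrow> v (V (Suc n) j - W (Suc n) j) \<le> e"
  shows "v (V n i - W n i) \<le> e / c"
proof -
  interpret V: jp_orbit v m c a V by fact
  interpret W: jp_orbit v m c a W by fact
  define A A' B B' where AB: "A = V (Suc n) 0" "A' = V (Suc n) (Suc i)"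
    "B = W (Suc n) 0" "B' = W (Suc n) (Suc i)"
  have vA: "c \<le> v A" "c \<le> v B" using V.large W.large by (auto simp: AB)
  then have nz: "A \<noteq> 0" "B \<noteq> 0" using V.c_gt_1 V.eq_0_iff[of A] V.eq_0_iff[of B] by auto
  have vB: "v (B' / B) \<le> 1" using W.dominated[of "Suc i" n] vA V.c_gt_1 \<open>i < m\<close>
    by (simp add: AB V.v_divide)
  have "V n i - W n i = A' / A - B' / B"
    using V.step[OF \<open>i < m\<close>, of n] W.step[OF \<open>i < m\<close>, of n] by (simp add: AB)
  also have "\<dots> = (A' - B') / A - B' / B * (A - B) / A" using nz by (simp add: field_simps)
  finally have "v (V n i - W n i) \<le> max (v ((A' - B') / A)) (v (B' / B * (A - B) / A))"
    using V.v_diff_le by simp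
  also have "v ((A' - B') / A) \<le> e / c" unfolding V.v_divide
    by (rule frac_le) (use e[of "Suc i"] \<open>i < m\<close> \<open>0 \<le> e\<close> vA V.c_gt_1 in \<open>auto simp: AB\<close>)
  moreover have "v (B' / B * (A - B) / A) \<le> e / c"
  proof -
    have "v (B' / B) * v (A - B) \<le> 1 * e"
      by (rule mult_mono) (use e[of 0] vB in \<open>auto simp: AB V.nonneg\<close>)
    then show ?thesis unfolding V.v_divide[of "_ * _"] V.mult
      by (intro frac_le) (use \<open>0 \<le> e\<close> vA V.c_gt_1 in auto)
  qed
  ultimately show ?thesis by (smt (verit))
qed

text \<open>
  At every time the two orbits are at distance at most 1, because both are that close to the partial
  quotients they share; applying the contraction from time \<open>n + k\<close> back to time \<open>n\<close> gives the bound
  \<open>c\<^sup>-\<^sup>k\<close> for all \<open>k\<close>.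
\<close>

lemma jp_orbit_unique:
  assumes "jp_orbit v m c a V" "jp_orbit v m c a W" "i \<le> m"
  shows "V n i = W n i"
proof -
  interpret V: jp_orbit v m c a V by fact
  interpret W: jp_orbit v m c a W by fact
  have le: "v (V n i - W n i) \<le> (1 / c) ^ k" if "i \<le> m" for k n i
    using that
  proof (induction k arbitrary: n i)
    case 0
    show ?case
    proof (cases "i < m")
      case True
      have "v (V (Suc n) (Suc i) / V (Suc n) 0) \<le> 1" "v (W (Suc n) (Suc i) / W (Suc n) 0) \<le> 1"
        using V.dominated[of "Suc i" n] W.dominated[of "Suc i" n] V.large[of n] W.large[of n]
          V.c_gt_1 True by (simp_all add: V.v_divide)
      moreover have "V n i - W n i =
          V (Suc n) (Suc i) / V (Suc n) 0 - W (Suc n) (Suc i) / W (Suc n) 0"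
        using V.step[OF True] W.step[OF True] by simp
      ultimately show ?thesis
        using V.v_diff_le[of "V (Suc n) (Suc i) / V (Suc n) 0" "W (Suc n) (Suc i) / W (Suc n) 0"]
        by simp
    next
      case False
      then show ?thesis using 0 V.last W.last V.eq_0_iff[of 0] by simp
    qed
  next
    case (Suc k)
    show ?case
    proof (cases "i < m")
      case True
      have "v (V n i - W n i) \<le> (1 / c) ^ k / c"
        by (rule jp_orbit_contraction[OF assms(1,2) True]) (use Suc.IH V.c_gt_1 in auto)
      then show ?thesis by simp
    next
      case False
      then show ?thesis using Suc.prems V.last W.last V.eq_0_iff[of 0] V.c_gt_1 by simp
    qed
  qed
  have "(\<lambda>k. (1 / c) ^ k) \<longlonglongrightarrow> 0"
    by (rule LIMSEQ_realpow_zero) (use V.c_gt_1 in auto)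
  then have "v (V n i - W n i) \<le> 0"
    by (rule tendsto_lowerbound) (use le[OF assms(3)] in auto)
  then show ?thesis using V.eq_0_iff[of "V n i - W n i"] V.nonneg[of "V n i - W n i"] by simp
qed

section \<open>The eigenvalues of a periodic orbit\<close>

locale periodic_jp_orbit = jp_orbit +
  fixes N :: nat
  assumes N_pos: "0 < N"
    and periodic: "i \<le> m \<Longrightarrow> V N i = V 0 i"
begin

text \<open>
  Time 0 coincides with time \<open>N > 0\<close>, which extends the bounds \<open>large\<close> and \<open>dominated\<close> to all times.
\<close>

lemma ex_positive_index: "\<exists>k. \<forall>i\<le>m. V n i = V (Suc k) i"
proof (cases n)
  case 0
  then show ?thesis using periodic N_pos by (metis gr0_implies_Suc)
qed blast

lemma large': "c \<le> v (V n 0)"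
  using ex_positive_index[of n] large by auto

lemma dominated': "i \<le> m \<Longrightarrow> v (V n i / V n 0) \<le> 1"
  using ex_positive_index[of n] dominated large' c_gt_1
  by (smt (verit) divide_le_eq_1 v_divide le0)

lemma V_0_nonzero: "V n 0 \<noteq> 0"
  using large'[of n] c_gt_1 eq_0_iff[of "V n 0"] by auto

definition multiplier :: 'a where
  "multiplier = (\<Prod>n<N. V n 0)"

lemma multiplier_gt_1: "1 < v multiplier"
proof -
  have "1 < v (V n 0)" for n using large'[of n] c_gt_1 by simp
  then have "1 < (\<Prod>n<N. v (V n 0))"
    using N_pos by (intro less_1_prod) auto
  then show ?thesis by (simp add: multiplier_def v_prod)
qed

lemma jp_matrix_V: "jp_matrix m (a n) *\<^sub>v vec (m + 1) (V (Suc n)) = V (Suc n) 0 \<cdot>\<^sub>v vec (m + 1) (V n)"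
proof (rule eq_vecI)
  fix i assume "i < dim_vec (V (Suc n) 0 \<cdot>\<^sub>v vec (m + 1) (V n))"
  then have i: "i \<le> m" by simp
  show "(jp_matrix m (a n) *\<^sub>v vec (m + 1) (V (Suc n))) $ i =
      (V (Suc n) 0 \<cdot>\<^sub>v vec (m + 1) (V n)) $ i"
  proof (cases "i < m")
    case True
    then have "V (Suc n) 0 * V n i = a n i * V (Suc n) 0 + V (Suc n) (Suc i)"
      using step[OF True, of n] V_0_nonzero[of "Suc n"] by (simp add: field_simps)
    then show ?thesis using True i by (subst jp_matrix_mult_vec) auto
  next
    case False
    then have "i = m" using i by simp
    then show ?thesis by (subst jp_matrix_mult_vec) (auto simp: last)
  qed
qed (simp add: jp_matrix_def)

lemma jp_prod_V:
  "jp_prod m a n *\<^sub>v vec (m + 1) (V n) = (\<Prod>k<n. V (Suc k) 0) \<cdot>\<^sub>v vec (m + 1) (V 0)"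
proof (induction n)
  case 0
  show ?case by (auto intro!: eq_vecI)
next
  case (Suc n)
  have "jp_prod m a (Suc n) *\<^sub>v vec (m + 1) (V (Suc n)) =
      jp_prod m a n *\<^sub>v (V (Suc n) 0 \<cdot>\<^sub>v vec (m + 1) (V n))"
    by (simp only: jp_prod_Suc_mult_vec[OF vec_carrier] jp_matrix_V)
  also have "\<dots> = V (Suc n) 0 \<cdot>\<^sub>v (jp_prod m a n *\<^sub>v vec (m + 1) (V n))"
    by (rule mult_mat_vec[OF jp_prod_carrier]) simp
  finally show ?case by (simp only: Suc smult_smult_assoc prod.lessThan_Suc mult.commute)
qed

text \<open>
  The product that appears naturally runs over the times \<open>1, \<dots>, N\<close>; by periodicity it is the same as
  the product over \<open>0, \<dots>, N - 1\<close>.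
\<close>

lemma eigenvector_V: "eigenvector (jp_prod m a N) (vec (m + 1) (V 0)) multiplier"
proof -
  have "(\<Prod>k<N. V (Suc k) 0) * V 0 0 = multiplier * V N 0"
    unfolding multiplier_def
    using prod.lessThan_Suc_shift[of "\<lambda>n. V n 0" N] prod.lessThan_Suc[of "\<lambda>n. V n 0" N]
    by (simp add: mult.commute)
  then have "(\<Prod>k<N. V (Suc k) 0) = multiplier"
    using periodic[of 0] V_0_nonzero[of 0] by simp
  moreover have "vec (m + 1) (V N) = vec (m + 1) (V 0)"
    using periodic by (auto intro!: eq_vecI)
  ultimately have "jp_prod m a N *\<^sub>v vec (m + 1) (V 0) = multiplier \<cdot>\<^sub>v vec (m + 1) (V 0)"
    using jp_prod_V[of N] by simp
  moreover have "vec (m + 1) (V 0) \<noteq> 0\<^sub>v (m + 1)"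
    using V_0_nonzero[of 0] by (metis index_vec index_zero_vec(1) zero_less_Suc Suc_eq_plus1)
  ultimately show ?thesis
    unfolding eigenvector_def using jp_prod_carrier[of m a N] by (auto simp: carrier_matD)
qed

text \<open>
  Subtracting the multiple of \<open>V n\<close> with the same coordinate 0 represents the class of \<open>x\<close> modulo
  \<open>V n\<close> by a vector whose coordinate 0 vanishes. The next two definitions are the coordinates of this
  vector and its maximum norm, which is a norm on the quotient by the line through \<open>V n\<close>.
\<close>

definition deviation :: "nat \<Rightarrow> 'a vec \<Rightarrow> nat \<Rightarrow> 'a" where
  "deviation n x i = x $ i - x $ 0 * (V n i / V n 0)"

definition quotient_norm :: "nat \<Rightarrow> 'a vec \<Rightarrow> real" where
  "quotient_norm n x = Max ((\<lambda>i. v (deviation n x i)) ` {..m})"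

lemma deviation_le_quotient_norm: "i \<le> m \<Longrightarrow> v (deviation n x i) \<le> quotient_norm n x"
  by (simp add: quotient_norm_def)

lemma quotient_norm_attained: "\<exists>i\<le>m. quotient_norm n x = v (deviation n x i)"
proof -
  have "quotient_norm n x \<in> (\<lambda>i. v (deviation n x i)) ` {..m}"
    unfolding quotient_norm_def by (rule Max_in) auto
  then show ?thesis by auto
qed

text \<open>
  Let \<open>t\<close> represent \<open>x\<close> modulo \<open>V (n + 1)\<close>. Up to a multiple of \<open>V n\<close>, the image of \<open>x\<close> is \<open>t\<close> shifted
  by one place, so its deviation at \<open>i\<close> is \<open>t (i + 1) - t 1 * V n i / V n 0\<close>, where both terms are at
  most the norm of \<open>t\<close>.
\<close>

lemma quotient_norm_jp_matrix_le:
  assumes x: "x \<in> carrier_vec (m + 1)"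
  shows "quotient_norm n (jp_matrix m (a n) *\<^sub>v x) \<le> quotient_norm (Suc n) x"
proof -
  define y where "y = jp_matrix m (a n) *\<^sub>v x"
  \<comment> \<open>The value 0 at \<open>m + 1\<close> fits the last row of the matrix, which contributes no shifted entry.\<close>
  define t where "t i = (if i \<le> m then deviation (Suc n) x i else 0)" for i
  have y: "y $ i = x $ 0 * V n i + t (Suc i)" if "i \<le> m" for i
  proof (cases "i < m")
    case True
    then show ?thesis
      using jp_matrix_mult_vec[OF x that, of "a n"] step[OF True, of n]
      by (simp add: y_def t_def deviation_def algebra_simps)
  next
    case False
    then have "i = m" using that by simp
    then show ?thesis using jp_matrix_mult_vec[OF x that, of "a n"] by (simp add: y_def t_def last)
  qed
  obtain i where i: "i \<le> m" "quotient_norm n y = v (deviation n y i)"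
    using quotient_norm_attained by blast
  have q: "v (t j) \<le> quotient_norm (Suc n) x" for j
  proof (cases "j \<le> m")
    case True
    then show ?thesis using deviation_le_quotient_norm by (simp add: t_def)
  next
    case False
    have "0 \<le> quotient_norm (Suc n) x" using quotient_norm_attained nonneg by metis
    then show ?thesis using False eq_0_iff[of 0] by (simp add: t_def)
  qed
  have "deviation n y i = t (Suc i) - t 1 * (V n i / V n 0)"
    unfolding deviation_def using y[OF i(1)] y[of 0] V_0_nonzero[of n] by (simp add: field_simps)
  then have "v (deviation n y i) \<le> max (v (t (Suc i))) (v (t 1) * v (V n i / V n 0))"
    using v_diff_le mult by metis
  moreover have "v (t 1) * v (V n i / V n 0) \<le> v (t 1) * 1"
    by (rule mult_left_mono[OF dominated'[OF i(1)] nonneg])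
  ultimately show ?thesis using i(2) q[of "Suc i"] q[of 1] unfolding y_def by simp
qed

lemma quotient_norm_jp_prod_le:
  "x \<in> carrier_vec (m + 1) \<Longrightarrow> quotient_norm 0 (jp_prod m a n *\<^sub>v x) \<le> quotient_norm n x"
proof (induction n arbitrary: x)
  case (Suc n)
  have "quotient_norm 0 (jp_prod m a (Suc n) *\<^sub>v x) \<le> quotient_norm n (jp_matrix m (a n) *\<^sub>v x)"
    unfolding jp_prod_Suc_mult_vec[OF Suc.prems]
    by (rule Suc.IH) (rule mult_mat_vec_carrier[OF jp_matrix_carrier Suc.prems])
  also have "\<dots> \<le> quotient_norm (Suc n) x" by (rule quotient_norm_jp_matrix_le[OF Suc.prems])
  finally show ?case .
qed simp

text \<open>
  An eigenvector whose class modulo \<open>V 0\<close> vanishes is a multiple of \<open>V 0\<close> and has the eigenvalue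
  \<open>multiplier\<close>. Otherwise its class has positive norm, is multiplied by \<open>l\<close>, and is not increased.
\<close>

lemma other_eigenvalue_le_1:
  assumes "eigenvalue (jp_prod m a N) l" "l \<noteq> multiplier"
  shows "v l \<le> 1"
proof -
  have dim: "dim_row (jp_prod m a N) = m + 1" using jp_prod_carrier by (rule carrier_matD)
  obtain u where u: "u \<in> carrier_vec (m + 1)" "u \<noteq> 0\<^sub>v (m + 1)" "jp_prod m a N *\<^sub>v u = l \<cdot>\<^sub>v u"
    using assms(1) unfolding eigenvalue_def eigenvector_def dim by blast
  obtain i where i: "i \<le> m" "quotient_norm 0 u = v (deviation 0 u i)"
    using quotient_norm_attained by blast
  have "quotient_norm 0 u \<noteq> 0"
  proof
    assume 0: "quotient_norm 0 u = 0"
    define b where "b = u $ 0 / V 0 0"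
    have "u $ j = b * V 0 j" if "j \<le> m" for j
      using deviation_le_quotient_norm[OF that, of 0 u] 0 nonneg[of "deviation 0 u j"]
        eq_0_iff[of "deviation 0 u j"] by (simp add: deviation_def b_def)
    then have "u = b \<cdot>\<^sub>v vec (m + 1) (V 0)"
      using u(1) by (intro eq_vecI) auto
    moreover from this have "b \<noteq> 0" using u(2) by auto
    moreover have "jp_prod m a N *\<^sub>v vec (m + 1) (V 0) = multiplier \<cdot>\<^sub>v vec (m + 1) (V 0)"
      using eigenvector_V unfolding eigenvector_def by blast
    ultimately have "l \<cdot>\<^sub>v u = multiplier \<cdot>\<^sub>v u"
      using u(3) mult_mat_vec[OF jp_prod_carrier vec_carrier, of m a N b "V 0"]
      by (simp add: smult_smult_assoc mult.commute)
    moreover have "u $ 0 \<noteq> 0"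
      using \<open>u = _\<close> \<open>b \<noteq> 0\<close> V_0_nonzero[of 0] by (auto simp: b_def)
    moreover have "(l \<cdot>\<^sub>v u) $ 0 = l * u $ 0" "(multiplier \<cdot>\<^sub>v u) $ 0 = multiplier * u $ 0"
      using u(1) by auto
    ultimately show False using assms(2) by (metis mult_right_cancel)
  qed
  then have pos: "0 < quotient_norm 0 u" using i(2) nonneg[of "deviation 0 u i"] by simp
  have "deviation 0 (l \<cdot>\<^sub>v u) i = l * deviation 0 u i"
    using u(1) i(1) by (simp add: deviation_def algebra_simps)
  then have "v l * quotient_norm 0 u = v (deviation 0 (jp_prod m a N *\<^sub>v u) i)"
    using i(2) u(3) mult by simp
  also have "\<dots> \<le> quotient_norm 0 (jp_prod m a N *\<^sub>v u)"
    by (rule deviation_le_quotient_norm[OF i(1)])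
  also have "\<dots> \<le> quotient_norm N u" by (rule quotient_norm_jp_prod_le[OF u(1)])
  also have "\<dots> = quotient_norm 0 u"
    unfolding quotient_norm_def deviation_def using periodic by (intro arg_cong[of _ _ Max] image_cong) auto
  finally show ?thesis using pos by simp
qed

end

lemma periodic_jp_orbit_map:
  assumes "periodic_jp_orbit v m c a V N" "comm_ring_hom h" "nonarch_abs w"
    and hd: "\<And>x y. h (x / y) = h x / h y" and wh: "\<And>x. w (h x) = v x"
  shows "periodic_jp_orbit w m c (\<lambda>n i. h (a n i)) (\<lambda>n i. h (V n i)) N"
proof -
  interpret periodic_jp_orbit v m c a V N by fact
  interpret w: nonarch_abs w by fact
  interpret h: comm_ring_hom h by fact
  show ?thesis
  proof unfold_locales
    fix i n assume "i < m"
    show "h (V n i) = h (a n i) + h (V (Suc n) (Suc i)) / h (V (Suc n) 0)"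
      using arg_cong[OF step[OF \<open>i < m\<close>, of n], of h] by (simp add: hd h.hom_add)
  qed (use m_pos c_gt_1 last large dominated N_pos periodic in \<open>simp_all add: wh\<close>)
qed

section \<open>p-adic complete quotients\<close>

context padic_numbers
begin

text \<open>
  The partial quotients and matrix rows are numbered from 0 in what precedes, whereas the algorithm
  numbers them from 1; hence the successor.
\<close>

definition homogeneous_quotient :: "nat \<Rightarrow> (nat \<Rightarrow> 'a) \<Rightarrow> nat \<Rightarrow> nat \<Rightarrow> 'a" where
  "homogeneous_quotient m \<alpha>0 n i = (if i < m then complete_quotient v p m \<alpha>0 n (Suc i) else 1)"

text \<open>
  All coordinates at time \<open>n + 1\<close> are fractions with the denominator \<open>d n\<close>, which is at most \<open>1/p\<close> in
  absolute value. The numerator is 1 for coordinate 0 and at most \<open>1/p\<close> or equal to \<open>d n\<close> for the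
  others, and so at most 1.
\<close>

lemma jp_orbit_homogeneous_quotient:
  assumes "odd p" "0 < m" "mcf_infinite v p m \<alpha>0"
  shows "jp_orbit v m (real p) (\<lambda>n i. partial_quotient v p m \<alpha>0 n (Suc i))
    (homogeneous_quotient m \<alpha>0)"
proof -
  let ?\<alpha> = "complete_quotient v p m \<alpha>0" and ?a = "partial_quotient v p m \<alpha>0"
  let ?V = "homogeneous_quotient m \<alpha>0"
  define d where "d n = ?\<alpha> n m - ?a n m" for n
  have d0: "d n \<noteq> 0" for n using assms(3) by (simp add: d_def mcf_infinite_def)
  have close: "v (?\<alpha> n i - ?a n i) \<le> 1 / real p" for n i
    unfolding partial_quotient_def by (rule browkin_s_close[OF assms(1)])
  have V0: "?V (Suc n) 0 = 1 / d n" for n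
    using assms(2) by (simp add: homogeneous_quotient_def d_def partial_quotient_def Let_def)
  have VSuc: "?V (Suc n) (Suc i) = (?\<alpha> n (Suc i) - ?a n (Suc i)) / d n" if "i < m" for n i
  proof (cases "Suc i < m")
    case True
    then show ?thesis
      by (simp add: homogeneous_quotient_def d_def partial_quotient_def Let_def)
  next
    case False
    then have "Suc i = m" using that by simp
    then show ?thesis using d0[of n] by (simp add: homogeneous_quotient_def d_def)
  qed
  have vd: "0 < v (d n)" for n using d0[of n] nonneg eq_0_iff by (metis less_eq_real_def)
  have large: "real p \<le> v (?V (Suc n) 0)" for n
    using close[of n m] vd[of n] p_gt_1 by (simp add: V0 v_divide v_one d_def[symmetric] field_simps)
  show ?thesis
  proof unfold_locales
    show "?V n m = 1" for n by (simp add: homogeneous_quotient_def)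
  next
    fix i n assume "i < m"
    then show "?V n i = ?a n (Suc i) + ?V (Suc n) (Suc i) / ?V (Suc n) 0"
      using d0[of n] by (simp add: VSuc V0) (simp add: homogeneous_quotient_def)
  next
    fix i n assume "i \<le> m"
    show "v (?V (Suc n) i) \<le> v (?V (Suc n) 0)"
    proof (cases i)
      case (Suc j)
      then have "v (?V (Suc n) i) = v (?\<alpha> n (Suc j) - ?a n (Suc j)) / v (d n)"
        using VSuc \<open>i \<le> m\<close> by (simp add: v_divide)
      also have "\<dots> \<le> 1 / v (d n)"
      proof (rule divide_right_mono)
        have "1 / real p \<le> 1" using p_gt_1 by simp
        then show "v (?\<alpha> n (Suc j) - ?a n (Suc j)) \<le> 1" using close[of n "Suc j"] by linarith
      qed (rule nonneg)
      also have "\<dots> = v (?V (Suc n) 0)" by (simp add: V0 v_divide v_one)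
      finally show ?thesis .
    qed simp
  qed (use assms(2) p_gt_1 large in auto)
qed

text \<open>
  The orbit shifted by \<open>N\<close> has the same partial quotients, so by uniqueness it is the same orbit.
\<close>

lemma periodic_homogeneous_quotient:
  assumes "odd p" "0 < m" "0 < N" "mcf_purely_periodic v p m \<alpha>0 N"
  shows "periodic_jp_orbit v m (real p) (\<lambda>n i. partial_quotient v p m \<alpha>0 n (Suc i))
    (homogeneous_quotient m \<alpha>0) N"
proof -
  let ?a = "\<lambda>n i. partial_quotient v p m \<alpha>0 n (Suc i)" and ?V = "homogeneous_quotient m \<alpha>0"
  have inf: "mcf_infinite v p m \<alpha>0"
    and per: "i < m \<Longrightarrow> ?a (n + N) i = ?a n i" for i n
    using assms(4) by (auto simp: mcf_purely_periodic_def)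
  interpret V: jp_orbit v m "real p" ?a ?V
    by (rule jp_orbit_homogeneous_quotient[OF assms(1,2) inf])
  have shift: "jp_orbit v m (real p) ?a (\<lambda>n. ?V (n + N))"
  proof unfold_locales
    fix i n assume "i < m"
    show "?V (n + N) i = ?a n i + ?V (Suc n + N) (Suc i) / ?V (Suc n + N) 0"
      using V.step[OF \<open>i < m\<close>, of "n + N"] per[OF \<open>i < m\<close>, of n] by simp
  next
    fix i n assume "i \<le> m"
    then show "v (?V (Suc n + N) i) \<le> v (?V (Suc n + N) 0)"
      using V.dominated[of i "n + N"] by simp
  next
    show "real p \<le> v (?V (Suc n + N) 0)" for n using V.large[of "n + N"] by simp
  qed (use assms(2) p_gt_1 V.last in auto)
  show ?thesis
  proof unfold_locales
    fix i assume "i \<le> m"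
    then show "?V N i = ?V 0 i"
      using jp_orbit_unique[OF shift V.jp_orbit_axioms, of i 0] by simp
  qed (use assms(3) in auto)
qed

end

lemma mcf_matrix_prod_eq_jp_prod:
  "mcf_matrix_prod v p m \<alpha>0 n = jp_prod m (\<lambda>n i. partial_quotient v p m \<alpha>0 n (Suc i)) n"
proof -
  have "mcf_matrix v p m \<alpha>0 k = jp_matrix m (\<lambda>i. partial_quotient v p m \<alpha>0 k (Suc i))" for k
    unfolding mcf_matrix_def jp_matrix_def by (rule cong_mat) auto
  then show ?thesis by (induction n) simp_all
qed

lemma comm_ring_hom_to_ac: "comm_ring_hom (to_ac :: 'a::field \<Rightarrow> 'a alg_closure)"
  by unfold_locales simp_all

theorem theorem2:
  fixes v :: "'a::field_char_0 \<Rightarrow> real"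
    and w :: "'a alg_closure \<Rightarrow> real"
    and p m N :: nat
    and \<alpha>0 :: "nat \<Rightarrow> 'a"
    and \<mu> :: 'a
  assumes "padic_numbers v p" and "odd p"
    and "nonarch_abs w" and "\<And>x. w (to_ac x) = v x"
    and "m \<ge> 1" and "N \<ge> 1"
    and "mcf_purely_periodic v p m \<alpha>0 N"
    and "\<mu> = (\<Prod>n<N. complete_quotient v p m \<alpha>0 n 1)"
  shows "poly (mcf_char_poly v p m \<alpha>0 N) \<mu> = 0 \<and>
         (\<forall>z::'a alg_closure. poly (map_poly to_ac (mcf_char_poly v p m \<alpha>0 N)) z = 0 \<and>
              z \<noteq> to_ac \<mu> \<longrightarrow> w z < w (to_ac \<mu>))"
proof -
  interpret padic_numbers v p by fact
  interpret to_ac: comm_ring_hom "to_ac :: 'a \<Rightarrow> 'a alg_closure" by (rule comm_ring_hom_to_ac)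
  let ?a = "\<lambda>n i. partial_quotient v p m \<alpha>0 n (Suc i)" and ?V = "homogeneous_quotient m \<alpha>0"
  have m: "0 < m" and N: "0 < N" using assms(5,6) by auto
  interpret K: periodic_jp_orbit v m "real p" ?a ?V N
    by (rule periodic_homogeneous_quotient[OF assms(2) m N assms(7)])
  interpret L: periodic_jp_orbit w m "real p" "\<lambda>n i. to_ac (?a n i)" "\<lambda>n i. to_ac (?V n i)" N
    by (rule periodic_jp_orbit_map[OF K.periodic_jp_orbit_axioms comm_ring_hom_to_ac assms(3)])
       (simp_all add: assms(4))
  have \<mu>: "K.multiplier = \<mu>"
    using m by (simp add: K.multiplier_def assms(8) homogeneous_quotient_def)
  then have \<mu>L: "L.multiplier = to_ac \<mu>"
    by (simp add: K.multiplier_def L.multiplier_def to_ac_prod[symmetric])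
  have P: "mcf_char_poly v p m \<alpha>0 N = char_poly (jp_prod m ?a N)"
    by (simp add: mcf_char_poly_def mcf_matrix_prod_eq_jp_prod)
  have PL: "map_poly to_ac (mcf_char_poly v p m \<alpha>0 N) =
      char_poly (jp_prod m (\<lambda>n i. to_ac (?a n i)) N)"
    unfolding P to_ac.char_poly_hom[OF jp_prod_carrier, symmetric]
      map_mat_jp_prod[OF comm_ring_hom_to_ac] ..
  have "eigenvalue (jp_prod m ?a N) \<mu>"
    unfolding eigenvalue_def using K.eigenvector_V \<mu> by auto
  then have "poly (mcf_char_poly v p m \<alpha>0 N) \<mu> = 0"
    unfolding P using eigenvalue_root_char_poly[OF jp_prod_carrier] by blast
  moreover have "w z < w (to_ac \<mu>)"
    if "poly (map_poly to_ac (mcf_char_poly v p m \<alpha>0 N)) z = 0" "z \<noteq> to_ac \<mu>" for z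
  proof -
    have "eigenvalue (jp_prod m (\<lambda>n i. to_ac (?a n i)) N) z"
      using that(1) unfolding PL eigenvalue_root_char_poly[OF jp_prod_carrier] .
    then have "w z \<le> 1" using L.other_eigenvalue_le_1 that(2) \<mu>L by simp
    also have "1 < w (to_ac \<mu>)" using L.multiplier_gt_1 \<mu>L by simp
    finally show ?thesis .
  qed
  ultimately show ?thesis by blast
qed

end
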